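(* Let $\Omega\subset D_m$ be generic, $\Lambda=\{(t,x_t):t\in\mathbb{R}_+,x\in\Omega\}$, and let $F\in\mathcal{S}(\Lambda)$ be a functional of class $\mathcal{S}$. Then for any $(T,x_T)\in\Lambda$ the limit $$\int_0^T\nabla_xF(t,x_{t-})\,dx:=\lim_{n\to\infty}\sum_{\pi_n\ni t_i\le T}\nabla_xF(t_i,x^n_{t_i-})\cdot(x(t_{i+1})-x(t_i))$$ exists, and $$F(T,x_T)=F(0,x_0)+\int_0^T\mathcal{D}F(t,x_t)\,dt+\int_0^T\nabla_xF(t,x_{t-})\,dx .$$
   Context: Partitions: $\pi=(\pi_n)_{n\ge1}$ is a fixed sequence of partitions $\pi_n=(0=t^n_0<\dots<t^n_{k_n}<\infty)$ of $[0,\infty)$ with $t^n_{k_n}\to\infty$ and mesh vanishing on compacts; the superscript $n$ is dropped and sums involving $t_{i+1}$ run over $i<k_n$. Paths: $D_m$ is the space of càdlàg functions $[0,\infty)\to\mathbb{R}^m$, $x(0-):=x(0)$, $\Delta x(t):=x(t)-x(t-)$; $x_t(s):=x(s\wedge t)$, $x_{t-}(s):=x(s)1_{s<t}+x(t-)1_{s\ge t}$. $x^n:=\sum_{t_i\in\pi_n}x(t_{i+1})1_{[t_i,t_{i+1})}$, and $x^n_t,x^n_{t-}$ are the stopped versions of $x^n$. Generic sets: a nonempty $\Omega\subset D_m$ is generic if (i) for every $x\in\Omega$, $T>0$ there is $N=N_T(x)$ with $x^n_T\in\Omega$ for all $n\ge N$; (ii) for every $x\in\Omega$, $t\ge0$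 there is a convex neighbourhood $\mathcal{U}$ of $0$ in $\mathbb{R}^m$ with $-\Delta x(t)\in\mathcal{U}$ and $x_t+e1_{[t,\infty)}\in\Omega$ for all $e\in\mathcal{U}$. Continuity of functionals $F$ on $\Lambda$: let $t'_n:=\max\{t_i<t:t_i\in\pi_n\}$ (and $0$ if there is no such $t_i$). $F$ is left-continuous if for all $(t,x_t)\in\Lambda$ ($x\in\Omega$): 1(a) $\lim_{s\uparrow t,\,s\le t}F(s,x_{s-})=F(t,x_{t-})$; 1(b) $\lim_{s\uparrow t,\,s<t}F(s,x_s)=F(t,x_{t-})$; 1(c) $t_n\to t$, $t_n\le t'_n$ implies $F(t_n,x^n_{t_n-})\to F(t,x_{t-})$; 1(d) $t_n\to t$, $t_n<t'_n$ implies $F(t_n,x^n_{t_n})\to F(t,x_{t-})$. $F$ is right-continuous if for all such $(t,x_t)$: 2(a) $\lim_{s\downarrow t,\,s\ge t}F(s,x_s)=F(t,x_t)$; 2(b) $\lim_{s\downarrow t,\,s>t}F(s,x_{s-})=F(t,x_t)$; 2(c) $t_n\to t$, $t_n\ge t'_n$ implies $F(t_n,x^n_{t_n})\to F(t,x_t)$; 2(d) $t_n\to t$, $t_n>t'_n$ implies $F(t_n,x^n_{t_n-})\to F(t,x_t)$. $F$ is continuous if it is both left- and right-continuous. Vector-valued functionals: componentwise. Derivatives: $\mathcal{D}F(t,x_t):=\lim_{h\downarrow0}\frac{F(t+h,x_t)-F(t,x_t)}{h}$ (horizontal derivative); $\nabla_xF(t,x_t)$ is the gradient at $e=0$ of $e\mapsto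 F(t,x_t+e1_{[t,\infty)})$ (vertical derivative). $F$ is differentiable if both exist at every point of $\Lambda$. $F$ is locally bounded if for every $x\in\Omega$, $T\ge0$ there is $n_0\ge N_T(x)$ such that the family $(t\mapsto F(t,x^n_t))_{n\ge n_0}$ is bounded on $[0,T]$ uniformly in $n\ge n_0$. $F$ is strictly causal if $F(t,x_t)=F(t,x_{t-})$ for all $(t,x_t)\in\Lambda$. Class $\mathcal{S}(\Lambda)$: continuous differentiable $F:\Lambda\to\mathbb{R}$ such that $\mathcal{D}F$ is right-continuous and locally bounded, and $\nabla_xF$ is left-continuous and strictly causal. *)

theory Defs
  imports "HOL-Analysis.Analysis"
begin

section \<open>Paths\<close>

text \<open>
  A path on the half-line is represented by a function on all reals that vanishes on the
  negative half-line. This makes the representation unique, and stopping, adding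
  \<open>e 1\<^bsub>[t,\<infinity>)\<^esub>\<close> with \<open>t \<ge> 0\<close>, and the piecewise constant approximation below all
  preserve it.
\<close>

type_synonym 'm path = "real \<Rightarrow> real ^ 'm"

definition cadlag_paths :: "('m::finite) path set" where
  "cadlag_paths = {x.
     (\<forall>t<0. x t = 0) \<and>
     (\<forall>t\<ge>0. (x \<longlongrightarrow> x t) (at_right t)) \<and>
     (\<forall>t>0. \<exists>l. (x \<longlongrightarrow> l) (at_left t))}"

definition left_lim :: "('m::finite) path \<Rightarrow> real \<Rightarrow> real ^ 'm" where
  "left_lim x t = (if t \<le> 0 then x 0 else Lim (at_left t) x)"

definition jump :: "('m::finite) path \<Rightarrow> real \<Rightarrow> real ^ 'm" where
  "jump x t = x t - left_lim x t"

definition stop :: "('m::finite) path \<Rightarrow> real \<Rightarrow> 'm path" where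
  "stop x t = (\<lambda>s. x (min s t))"

definition stop_left :: "('m::finite) path \<Rightarrow> real \<Rightarrow> 'm path" where
  "stop_left x t = (\<lambda>s. if s < t then x s else left_lim x t)"

definition bump :: "('m::finite) path \<Rightarrow> real \<Rightarrow> real ^ 'm \<Rightarrow> 'm path" where
  "bump y t e = (\<lambda>s. y s + indicator {t..} s *\<^sub>R e)"


section \<open>Partitions\<close>

text \<open>
  The partition \<open>\<pi> n\<close> is the strictly increasing list of its points, so that
  \<open>t\<^sub>i = \<pi> n ! i\<close> and \<open>k\<^sub>n = length (\<pi> n) - 1\<close>.
\<close>

definition partition_sequence :: "(nat \<Rightarrow> real list) \<Rightarrow> bool" where
  "partition_sequence \<pi> \<longleftrightarrow>
     (\<forall>n. \<pi> n \<noteq> [] \<and> hd (\<pi> n) = 0 \<and> sorted_wrt (<) (\<pi> n)) \<and>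
     filterlim (\<lambda>n. last (\<pi> n)) at_top sequentially \<and>
     (\<forall>T>0. \<forall>\<epsilon>>0. \<forall>\<^sub>F n in sequentially.
        \<forall>i < length (\<pi> n) - 1. \<pi> n ! i \<le> T \<longrightarrow> \<pi> n ! Suc i - \<pi> n ! i < \<epsilon>)"

text \<open>The approximation uses the value at the right end point of each interval.\<close>

definition approx :: "(nat \<Rightarrow> real list) \<Rightarrow> nat \<Rightarrow> ('m::finite) path \<Rightarrow> 'm path" where
  "approx \<pi> n x =
     (\<lambda>s. \<Sum>i < length (\<pi> n) - 1. indicator {\<pi> n ! i ..< \<pi> n ! Suc i} s *\<^sub>R x (\<pi> n ! Suc i))"

definition prev_point :: "(nat \<Rightarrow> real list) \<Rightarrow> nat \<Rightarrow> real \<Rightarrow> real" where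
  "prev_point \<pi> n t =
     (if \<exists>s \<in> set (\<pi> n). s < t then Max {s \<in> set (\<pi> n). s < t} else 0)"


section \<open>Generic sets and causal functionals\<close>

definition generic :: "(nat \<Rightarrow> real list) \<Rightarrow> ('m::finite) path set \<Rightarrow> bool" where
  "generic \<pi> \<Omega> \<longleftrightarrow>
     \<Omega> \<noteq> {} \<and> \<Omega> \<subseteq> cadlag_paths \<and>
     (\<forall>x\<in>\<Omega>. \<forall>T>0. \<exists>N. \<forall>n\<ge>N. stop (approx \<pi> n x) T \<in> \<Omega>) \<and>
     (\<forall>x\<in>\<Omega>. \<forall>t\<ge>0. \<exists>U. convex U \<and> 0 \<in> interior U \<and> - jump x t \<in> U \<and>
        (\<forall>e\<in>U. bump (stop x t) t e \<in> \<Omega>))"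

definition stopped_paths :: "('m::finite) path set \<Rightarrow> (real \<times> 'm path) set" where
  "stopped_paths \<Omega> = {(t, stop x t) | t x. 0 \<le> t \<and> x \<in> \<Omega>}"

text \<open>
  Functionals are total functions on pairs. For generic \<open>\<Omega>\<close>, everything below depends only on
  their values on \<open>stopped_paths \<Omega>\<close>: indeed \<open>stop_left x t\<close> is \<open>bump (stop x t) t (- jump x t)\<close>,
  and the stopped approximations lie in \<open>\<Omega>\<close> for large \<open>n\<close>.
\<close>

type_synonym ('m, 'b) functional = "real \<times> 'm path \<Rightarrow> 'b"

text \<open>
  The filter \<^term>\<open>at t within S\<close> ignores \<open>t\<close> itself, so including the end point as in the usual
  formulation makes no difference; restricting to \<open>s \<ge> 0\<close> matters at \<open>t = 0\<close>, where the
  left-hand limits over \<open>s\<close> are void.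
\<close>

definition left_cont_functional ::
  "(nat \<Rightarrow> real list) \<Rightarrow> ('m::finite) path set \<Rightarrow> ('m, 'b::topological_space) functional \<Rightarrow> bool"
where
  "left_cont_functional \<pi> \<Omega> F \<longleftrightarrow> (\<forall>x\<in>\<Omega>. \<forall>t\<ge>0.
     ((\<lambda>s. F (s, stop_left x s)) \<longlongrightarrow> F (t, stop_left x t)) (at t within {0..t}) \<and>
     ((\<lambda>s. F (s, stop x s)) \<longlongrightarrow> F (t, stop_left x t)) (at t within {0..<t}) \<and>
     (\<forall>r. (\<forall>n. 0 \<le> r n) \<and> r \<longlonglongrightarrow> t \<and> (\<forall>\<^sub>F n in sequentially. r n \<le> prev_point \<pi> n t) \<longrightarrow>
        (\<lambda>n. F (r n, stop_left (approx \<pi> n x) (r n))) \<longlonglongrightarrow> F (t, stop_left x t)) \<and>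
     (\<forall>r. (\<forall>n. 0 \<le> r n) \<and> r \<longlonglongrightarrow> t \<and> (\<forall>\<^sub>F n in sequentially. r n < prev_point \<pi> n t) \<longrightarrow>
        (\<lambda>n. F (r n, stop (approx \<pi> n x) (r n))) \<longlonglongrightarrow> F (t, stop_left x t)))"

definition right_cont_functional ::
  "(nat \<Rightarrow> real list) \<Rightarrow> ('m::finite) path set \<Rightarrow> ('m, 'b::topological_space) functional \<Rightarrow> bool"
where
  "right_cont_functional \<pi> \<Omega> F \<longleftrightarrow> (\<forall>x\<in>\<Omega>. \<forall>t\<ge>0.
     ((\<lambda>s. F (s, stop x s)) \<longlongrightarrow> F (t, stop x t)) (at t within {t..}) \<and>
     ((\<lambda>s. F (s, stop_left x s)) \<longlongrightarrow> F (t, stop x t)) (at t within {t<..}) \<and>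
     (\<forall>r. (\<forall>n. 0 \<le> r n) \<and> r \<longlonglongrightarrow> t \<and> (\<forall>\<^sub>F n in sequentially. r n \<ge> prev_point \<pi> n t) \<longrightarrow>
        (\<lambda>n. F (r n, stop (approx \<pi> n x) (r n))) \<longlonglongrightarrow> F (t, stop x t)) \<and>
     (\<forall>r. (\<forall>n. 0 \<le> r n) \<and> r \<longlonglongrightarrow> t \<and> (\<forall>\<^sub>F n in sequentially. r n > prev_point \<pi> n t) \<longrightarrow>
        (\<lambda>n. F (r n, stop_left (approx \<pi> n x) (r n))) \<longlonglongrightarrow> F (t, stop x t)))"

definition cont_functional ::
  "(nat \<Rightarrow> real list) \<Rightarrow> ('m::finite) path set \<Rightarrow> ('m, 'b::topological_space) functional \<Rightarrow> bool"
where
  "cont_functional \<pi> \<Omega> F \<longleftrightarrow> left_cont_functional \<pi> \<Omega> F \<and> right_cont_functional \<pi> \<Omega> F"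

definition horiz_quotient :: "('m, real) functional \<Rightarrow> real \<times> ('m::finite) path \<Rightarrow> real \<Rightarrow> real" where
  "horiz_quotient F = (\<lambda>(t, y) h. (F (t + h, y) - F (t, y)) / h)"

definition horiz_deriv :: "('m, real) functional \<Rightarrow> real \<times> ('m::finite) path \<Rightarrow> real" where
  "horiz_deriv F p = Lim (at_right 0) (horiz_quotient F p)"

definition vert_map :: "('m, real) functional \<Rightarrow> real \<times> ('m::finite) path \<Rightarrow> real ^ 'm \<Rightarrow> real" where
  "vert_map F = (\<lambda>(t, y) e. F (t, bump y t e))"

definition vert_deriv :: "('m, real) functional \<Rightarrow> real \<times> ('m::finite) path \<Rightarrow> real ^ 'm" where
  "vert_deriv F p = (THE D. GDERIV (vert_map F p) 0 :> D)"

definition differentiable_functional ::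
  "('m::finite) path set \<Rightarrow> ('m, real) functional \<Rightarrow> bool"
where
  "differentiable_functional \<Omega> F \<longleftrightarrow> (\<forall>p \<in> stopped_paths \<Omega>.
     (\<exists>l. (horiz_quotient F p \<longlongrightarrow> l) (at_right 0)) \<and>
     (\<exists>D. GDERIV (vert_map F p) 0 :> D))"

definition locally_bounded_functional ::
  "(nat \<Rightarrow> real list) \<Rightarrow> ('m::finite) path set \<Rightarrow> ('m, 'b::metric_space) functional \<Rightarrow> bool"
where
  "locally_bounded_functional \<pi> \<Omega> F \<longleftrightarrow> (\<forall>x\<in>\<Omega>. \<forall>T\<ge>0. \<exists>n\<^sub>0.
     (\<forall>n\<ge>n\<^sub>0. stop (approx \<pi> n x) T \<in> \<Omega>) \<and>
     bounded {F (t, stop (approx \<pi> n x) t) | n t. n\<^sub>0 \<le> n \<and> t \<in> {0..T}})"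

definition strictly_causal :: "('m::finite) path set \<Rightarrow> ('m, 'b) functional \<Rightarrow> bool" where
  "strictly_causal \<Omega> F \<longleftrightarrow> (\<forall>x\<in>\<Omega>. \<forall>t\<ge>0. F (t, stop x t) = F (t, stop_left x t))"

definition class_S ::
  "(nat \<Rightarrow> real list) \<Rightarrow> ('m::finite) path set \<Rightarrow> ('m, real) functional set"
where
  "class_S \<pi> \<Omega> = {F.
     cont_functional \<pi> \<Omega> F \<and> differentiable_functional \<Omega> F \<and>
     right_cont_functional \<pi> \<Omega> (horiz_deriv F) \<and>
     locally_bounded_functional \<pi> \<Omega> (horiz_deriv F) \<and>
     left_cont_functional \<pi> \<Omega> (vert_deriv F) \<and>
     strictly_causal \<Omega> (vert_deriv F)}"


section \<open>The pathwise integral\<close>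

definition riemann_sum ::
  "(nat \<Rightarrow> real list) \<Rightarrow> ('m, real ^ 'm) functional \<Rightarrow> ('m::finite) path \<Rightarrow> real \<Rightarrow> nat \<Rightarrow> real"
where
  "riemann_sum \<pi> G x T n =
     (\<Sum>i | i < length (\<pi> n) - 1 \<and> \<pi> n ! i \<le> T.
        G (\<pi> n ! i, stop_left (approx \<pi> n x) (\<pi> n ! i)) \<bullet> (x (\<pi> n ! Suc i) - x (\<pi> n ! i)))"

definition pathwise_integral ::
  "(nat \<Rightarrow> real list) \<Rightarrow> ('m, real ^ 'm) functional \<Rightarrow> ('m::finite) path \<Rightarrow> real \<Rightarrow> real"
where
  "pathwise_integral \<pi> G x T = lim (riemann_sum \<pi> G x T)"

end

theory Submission
  imports Defs
begin

text \<open>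
  The right-continuous step approximation \<open>x\<^sup>n\<close> moves only at partition points. Between them \<open>F\<close>
  changes by the integral of its horizontal derivative, by a fundamental theorem of calculus for
  right derivatives. At a partition point the change is exactly the vertical derivative, taken
  before the jump, times the jump, because strict causality makes \<open>F\<close> affine in the jump size.
  Telescoping yields the formula for \<open>x\<^sup>n\<close>, in which the summand of the Riemann sum at \<open>t\<^sub>0 = 0\<close>
  does not occur, since \<open>x\<^sup>n\<close> starts at \<open>x(t\<^sub>1)\<close>; that summand tends to \<open>0\<close>. Everything except
  the Riemann sum converges, the integral of the horizontal derivative by dominated convergence, so
  the Riemann sum converges too.
\<close>

section \<open>Right derivatives and right-continuous integrands\<close>

text \<open>Real induction by compactness: for each slope \<open>\<epsilon> > 0\<close> the set
  \<open>A\<close> of points meeting the bound \<open>\<epsilon> * (t - a)\<close> is compact, so it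
  has a greatest element \<open>c\<close>. If \<open>c < b\<close>, the zero right derivative at
  \<open>c\<close> yields a point of \<open>A\<close> beyond \<open>c\<close>.\<close>

lemma right_derivative_zero_imp_eq:
  fixes h :: "real \<Rightarrow> real"
  assumes "a \<le> b" and cont: "continuous_on {a..b} h"
    and deriv: "\<And>t. a \<le> t \<Longrightarrow> t < b \<Longrightarrow> (h has_real_derivative 0) (at_right t)"
  shows "h b = h a"
proof -
  have le: "\<bar>h b - h a\<bar> \<le> \<epsilon> * (b - a)" if "\<epsilon> > 0" for \<epsilon>
  proof -
    define A where "A = {t \<in> {a..b}. \<bar>h t - h a\<bar> \<le> \<epsilon> * (t - a)}"
    have "closed A"
      unfolding A_def by (intro continuous_on_closed_Collect_le continuous_intros cont)
    then have "compact A"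
      unfolding A_def by (metis (no_types, lifting) bounded_closed_interval bounded_subset
          compact_eq_bounded_closed mem_Collect_eq subsetI)
    moreover have "a \<in> A"
      using \<open>a \<le> b\<close> by (simp add: A_def)
    ultimately obtain c where c: "c \<in> A" and max: "\<And>t. t \<in> A \<Longrightarrow> t \<le> c"
      using compact_attains_sup[of A] by auto
    have "c = b"
    proof (rule ccontr)
      assume "c \<noteq> b"
      with c have "a \<le> c" "c < b" by (auto simp: A_def)
      have "((\<lambda>t. (h t - h c) / (t - c)) \<longlongrightarrow> 0) (at_right c)"
        using deriv[OF \<open>a \<le> c\<close> \<open>c < b\<close>] by (simp add: has_field_derivative_iff)
      then have "\<forall>\<^sub>F t in at_right c. \<bar>(h t - h c) / (t - c)\<bar> < \<epsilon>"
        using \<open>\<epsilon> > 0\<close> by (auto dest!: tendstoD[where e = \<epsilon>])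
      moreover have "\<forall>\<^sub>F t in at_right c. t \<in> {c<..<b}"
        using \<open>c < b\<close> by (rule eventually_at_right_real)
      ultimately have "\<forall>\<^sub>F t in at_right c. c < t \<and> t < b \<and> \<bar>(h t - h c) / (t - c)\<bar> < \<epsilon>"
        by eventually_elim auto
      then obtain t where t: "c < t" "t < b" "\<bar>(h t - h c) / (t - c)\<bar> < \<epsilon>"
        by (auto dest!: eventually_happens'[OF trivial_limit_at_right_real])
      then have "\<bar>h t - h c\<bar> \<le> \<epsilon> * (t - c)"
        by (simp add: abs_divide divide_less_eq)
      with c have "\<bar>h t - h a\<bar> \<le> \<epsilon> * (t - a)"
        by (auto simp: A_def algebra_simps)
      with t \<open>a \<le> c\<close> have "t \<in> A" by (simp add: A_def)
      with max t show False by fastforce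
    qed
    with c show ?thesis by (simp add: A_def)
  qed
  have "\<bar>h b - h a\<bar> \<le> 0"
  proof (rule field_le_epsilon)
    fix e :: real assume "0 < e"
    \<comment> \<open>The summand \<open>1\<close> keeps the slope positive even when
      \<open>a = b\<close>.\<close>
    then have "\<bar>h b - h a\<bar> \<le> e / (b - a + 1) * (b - a)"
      using \<open>a \<le> b\<close> by (intro le) simp
    also have "\<dots> \<le> 0 + e"
      using \<open>0 < e\<close> \<open>a \<le> b\<close> by (simp add: field_simps)
    finally show "\<bar>h b - h a\<bar> \<le> 0 + e" .
  qed
  then show ?thesis by simp
qed

text \<open>Subtracting the indefinite integral of \<open>g\<close> from \<open>f\<close> leaves a
  continuous function whose right derivative vanishes, since right continuity of \<open>g\<close>
  makes \<open>g t\<close> the right derivative of its integral.\<close>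

lemma integral_right_derivative:
  fixes f g :: "real \<Rightarrow> real"
  assumes "a \<le> b" and cont: "continuous_on {a..b} f" and int: "g integrable_on {a..b}"
    and g: "\<And>t. a \<le> t \<Longrightarrow> t < b \<Longrightarrow> (g \<longlongrightarrow> g t) (at_right t)"
    and deriv: "\<And>t. a \<le> t \<Longrightarrow> t < b \<Longrightarrow> (f has_real_derivative g t) (at_right t)"
  shows "integral {a..b} g = f b - f a"
proof -
  define h where "h t = f t - integral {a..t} g" for t
  have "h b = h a"
  proof (rule right_derivative_zero_imp_eq[where h = h])
    show "continuous_on {a..b} h"
      unfolding h_def by (intro continuous_intros cont indefinite_integral_continuous_1 int)
    fix t assume t: "a \<le> t" "t < b"
    \<comment> \<open>For an integral based at \<open>t\<close>, continuity of \<open>g\<close> at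
      the base point within \<open>{t..b}\<close> is just right continuity. The base point is moved
      back to \<open>a\<close> afterwards.\<close>
    have "g integrable_on {t..b}"
      using integrable_on_subinterval[OF int] t by auto
    then have "((\<lambda>u. integral {t..u} g) has_vector_derivative g t) (at t within {t..b} - {})"
      using g[OF t] t
      by (intro integral_has_vector_derivative_continuous_at)
         (auto simp: continuous_within at_within_Icc_at_right)
    then have "((\<lambda>u. integral {t..u} g) has_real_derivative g t) (at_right t)"
      using t by (simp add: has_real_derivative_iff_has_vector_derivative at_within_Icc_at_right)
    then have "((\<lambda>u. integral {a..t} g + integral {t..u} g) has_real_derivative g t) (at_right t)"
      by (auto intro!: derivative_eq_intros)
    moreover have "integral {a..t} g + integral {t..u} g = integral {a..u} g" if "u \<in> {t..<b}" for u
      using that t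
      by (intro Henstock_Kurzweil_Integration.integral_combine integrable_on_subinterval[OF int]) auto
    then have "\<forall>\<^sub>F u in at_right t. integral {a..t} g + integral {t..u} g = integral {a..u} g"
      using eventually_at_right_real[OF t(2)] by (auto elim!: eventually_mono)
    ultimately have "((\<lambda>u. integral {a..u} g) has_real_derivative g t) (at_right t)"
      by (subst (asm) has_field_derivative_cong_eventually) auto
    from DERIV_diff[OF deriv[OF t] this] show "(h has_real_derivative 0) (at_right t)"
      unfolding h_def by simp
  qed fact
  then show ?thesis by (simp add: h_def)
qed

lemma borel_measurable_right_continuous:
  fixes g :: "real \<Rightarrow> real"
  assumes g: "\<And>t. 0 \<le> t \<Longrightarrow> (g \<longlongrightarrow> g t) (at_right t)"
  shows "set_borel_measurable lborel {0..T} g"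
proof -
  \<comment> \<open>\<open>r k t\<close> is the first point strictly to the right of
    \<open>t\<close> in the grid of mesh \<open>1 / (k + 1)\<close>. It tends to \<open>t\<close>
    without ever equalling it, so for \<open>t \<ge> 0\<close> right continuity applies to the
    samples \<open>g (r k t)\<close>.\<close>
  define r where "r k t = (real_of_int \<lfloor>(real k + 1) * t\<rfloor> + 1) / (real k + 1)" for k t
  define u where "u k t = indicator {0..T} t * g (r k t)" for k t
  have "(\<lambda>k. u k t) \<longlonglongrightarrow> indicator {0..T} t *\<^sub>R g t" for t
  proof -
  have gt: "t < r k t" for k
    unfolding r_def using floor_correct[of "(real k + 1) * t"]
    by (simp add: less_divide_eq mult.commute)
  have le: "r k t \<le> t + 1 / (real k + 1)" for k
  proof -
    have "r k t \<le> ((real k + 1) * t + 1) / (real k + 1)"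
      unfolding r_def by (intro divide_right_mono) auto
    also have "\<dots> = t + 1 / (real k + 1)"
      by (simp add: add_divide_distrib)
    finally show ?thesis .
  qed
  have "(\<lambda>k. t + 1 / (real k + 1)) \<longlonglongrightarrow> t + 0"
    using LIMSEQ_inverse_real_of_nat
    by (intro tendsto_intros) (simp add: inverse_eq_divide add.commute)
  then have "(\<lambda>k. r k t) \<longlonglongrightarrow> t"
    using gt le by (intro tendsto_sandwich[of "\<lambda>_. t" "\<lambda>k. r k t"]) (auto simp: less_imp_le)
  then have "filterlim (\<lambda>k. r k t) (at_right t) sequentially"
    using gt[THEN less_imp_neq, THEN not_sym] gt by (simp add: filterlim_at)
  then have "(\<lambda>k. g (r k t)) \<longlonglongrightarrow> g t" if "0 \<le> t"
    using filterlim_compose[OF g[OF that], of "\<lambda>k. r k t" sequentially] by simp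
  then show ?thesis
    by (cases "t \<in> {0..T}") (simp_all add: u_def)
  qed
  moreover have "u k \<in> borel_measurable lborel" for k
  proof -
    \<comment> \<open>The sample depends on \<open>t\<close> only through an integer, and every
      function on a discrete space is measurable.\<close>
    have "(\<lambda>t. g (r k t)) \<in> borel_measurable lborel"
      unfolding r_def
      by (rule measurable_compose[where f = "\<lambda>t. \<lfloor>(real k + 1) * t\<rfloor>" and N = "count_space UNIV"
            and g = "\<lambda>j. g ((real_of_int j + 1) / (real k + 1))"]) auto
    then show ?thesis
      unfolding u_def by simp
  qed
  ultimately show ?thesis
    unfolding set_borel_measurable_def by (rule borel_measurable_LIMSEQ_real[where u = u])
qed

section \<open>Stopped, bumped and locally constant paths\<close>

lemma stop_bump_stop: "stop (bump (stop y t) t e) t = bump (stop y t) t e"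
  by (auto simp: stop_def bump_def indicator_def fun_eq_iff)

lemma bump_bump: "bump (bump y t d) t e = bump y t (d + e)"
  by (auto simp: bump_def indicator_def fun_eq_iff)

lemma bump_stop_jump: "0 \<le> t \<Longrightarrow> bump (stop y t) t (- jump y t) = stop_left y t"
  by (auto simp: bump_def stop_def stop_left_def jump_def indicator_def fun_eq_iff)

lemma left_lim_cong:
  assumes "0 < t" "\<And>s. s < t \<Longrightarrow> y s = z s"
  shows "left_lim y t = left_lim z t"
proof -
  \<comment> \<open>No limit is assumed to exist, so the predicates defining \<open>Lim\<close> are
    compared. At \<open>t = 0\<close> the values before \<open>t\<close> would not decide,
    \<open>left_lim\<close> being \<open>y 0\<close> there by convention.\<close>
  have "(y \<longlongrightarrow> l) (at_left t) \<longleftrightarrow> (z \<longlongrightarrow> l) (at_left t)" for l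
    using assms(2) by (intro tendsto_cong) (auto simp: eventually_at_filter)
  then show ?thesis
    using \<open>0 < t\<close> by (simp add: left_lim_def t2_space_class.Lim_def)
qed

lemma stop_left_cong:
  assumes "0 < t" "\<And>s. s < t \<Longrightarrow> y s = z s"
  shows "stop_left y t = stop_left z t"
  using left_lim_cong[OF assms] assms by (auto simp: stop_left_def)

lemma left_lim_eq_const:
  assumes "0 \<le> a" "a < t" "\<And>s. a \<le> s \<Longrightarrow> s < t \<Longrightarrow> y s = c"
  shows "left_lim y t = c"
proof -
  have "\<forall>\<^sub>F s in at_left t. y s = c"
    using eventually_at_left_real[OF \<open>a < t\<close>] by eventually_elim (simp add: assms(3))
  then have "(y \<longlongrightarrow> c) (at_left t)"
    by (rule tendsto_eventually)
  then show ?thesis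
    using assms(1,2) by (simp add: left_lim_def tendsto_Lim)
qed

lemma stop_eq_of_const:
  assumes "\<And>s. a \<le> s \<Longrightarrow> s \<le> t \<Longrightarrow> y s = y a" "a \<le> t"
  shows "stop y t = stop y a"
  unfolding stop_def
proof
  fix s show "y (min s t) = y (min s a)"
    using assms(1)[of "min s t"] assms(2) by (cases "s \<le> a") (auto simp: min_def split: if_splits)
qed

text \<open>The path may jump at \<open>t\<close>, since only its values before \<open>t\<close>
  enter. This is why the right end of a constant stretch is handled with
  \<open>stop_left\<close>.\<close>

lemma stop_left_eq_of_const:
  assumes "\<And>s. a \<le> s \<Longrightarrow> s < t \<Longrightarrow> y s = y a" "0 \<le> a" "a < t"
  shows "stop_left y t = stop y a"
proof -
  have "left_lim y t = y a"
    using left_lim_eq_const[OF assms(2,3,1)] .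
  moreover have "y (min s a) = y s" if "s < t" for s
    using assms(1)[of s] that by (auto simp: min_def)
  ultimately show ?thesis
    using \<open>a < t\<close> by (auto simp: stop_left_def stop_def fun_eq_iff)
qed

section \<open>Change of a functional at a jump and along a constant stretch\<close>

lemma GDERIV_unique:
  assumes "GDERIV f x :> D" "GDERIV f x :> E"
  shows "D = E"
proof -
  have "(\<lambda>h. h \<bullet> D) = (\<lambda>h. h \<bullet> E)"
    using assms unfolding gderiv_def by (rule has_derivative_unique)
  then have "\<forall>h. h \<bullet> D = h \<bullet> E"
    by (simp add: fun_eq_iff)
  then show ?thesis
    by (simp only: vector_eq_ldot)
qed

lemma vert_deriv_eqI: "GDERIV (vert_map F p) 0 :> D \<Longrightarrow> vert_deriv F p = D"
  unfolding vert_deriv_def by (blast intro: GDERIV_unique)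

lemma horiz_deriv_tendsto:
  assumes "differentiable_functional \<Omega> F" "p \<in> stopped_paths \<Omega>"
  shows "(horiz_quotient F p \<longlongrightarrow> horiz_deriv F p) (at_right 0)"
  using assms tendsto_Lim[of "at_right (0::real)"]
  by (auto simp: differentiable_functional_def horiz_deriv_def)

text \<open>
  By strict causality the vertical gradient does not see the size of the jump at \<open>t\<close>, so \<open>F\<close> is
  affine in it.
\<close>

lemma jump_formula:
  assumes gen: "generic \<pi> \<Omega>" and diff: "differentiable_functional \<Omega> F"
    and causal: "strictly_causal \<Omega> (vert_deriv F)" and y: "y \<in> \<Omega>" and t: "0 < t"
  shows "F (t, stop y t) - F (t, stop_left y t) = vert_deriv F (t, stop_left y t) \<bullet> jump y t"
proof -
  let ?J = "jump y t" and ?G = "vert_deriv F (t, stop_left y t)"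
  define \<phi> where "\<phi> e = F (t, bump (stop y t) t e)" for e
  obtain U where U: "convex U" "0 \<in> interior U" "- ?J \<in> U"
    "\<And>e. e \<in> U \<Longrightarrow> bump (stop y t) t e \<in> \<Omega>"
    using gen y t unfolding generic_def by (meson less_imp_le)
  \<comment> \<open>Bumps at \<open>t\<close> add up, so the gradient of \<open>\<phi>\<close> at
    \<open>e\<close> is the vertical derivative at the bumped path \<open>?z\<close>. Strict
    causality moves it to \<open>stop_left ?z t\<close>, where the bump has become
    invisible.\<close>
  have grad: "GDERIV \<phi> e :> ?G" if "e \<in> U" for e
  proof -
    let ?z = "bump (stop y t) t e"
    have "(t, stop ?z t) \<in> stopped_paths \<Omega>"
      using U(4)[OF that] t by (force simp: stopped_paths_def)
    then obtain D where D: "GDERIV (vert_map F (t, ?z)) 0 :> D"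
      using diff by (auto simp: differentiable_functional_def stop_bump_stop)
    have "D = vert_deriv F (t, stop ?z t)"
      using vert_deriv_eqI[OF D] by (simp add: stop_bump_stop)
    also have "\<dots> = vert_deriv F (t, stop_left ?z t)"
      using causal U(4)[OF that] t by (simp add: strictly_causal_def)
    also have "stop_left ?z t = stop_left y t"
      using t by (intro stop_left_cong) (auto simp: bump_def stop_def)
    finally have "((\<lambda>d. \<phi> (e + d)) has_derivative (\<lambda>h. h \<bullet> ?G)) (at 0)"
      using D by (simp add: gderiv_def vert_map_def bump_bump \<phi>_def)
    then have "((\<lambda>d. \<phi> (e + d)) \<circ> (\<lambda>d. d - e) has_derivative (\<lambda>h. h \<bullet> ?G) \<circ> (\<lambda>h. h)) (at e)"
      by (intro diff_chain_at) (auto intro!: derivative_eq_intros)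
    then show ?thesis
      by (simp add: gderiv_def o_def)
  qed
  \<comment> \<open>The segment from \<open>0\<close> to \<open>- ?J\<close> stays in
    \<open>U\<close> by convexity and joins the stopped path to the left-stopped one. Along it the
    derivative is constant, so the mean value theorem gives the exact difference.\<close>
  define \<psi> where "\<psi> s = \<phi> (s *\<^sub>R (- ?J))" for s :: real
  have "(\<psi> has_real_derivative - (?G \<bullet> ?J)) (at s)" if "0 \<le> s" "s \<le> 1" for s
  proof -
    have "s *\<^sub>R (- ?J) \<in> U"
      using convexD_alt[OF U(1) _ U(3), of 0 s] U(2) interior_subset that by auto
    from grad[OF this] have "(\<phi> \<circ> (\<lambda>s. s *\<^sub>R (- ?J)) has_derivative
        (\<lambda>h. h \<bullet> ?G) \<circ> (\<lambda>h. h *\<^sub>R (- ?J))) (at s)"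
      unfolding gderiv_def by (intro diff_chain_at) (auto intro!: derivative_eq_intros)
    then show ?thesis
      unfolding \<psi>_def has_field_derivative_def o_def
      by (rule has_derivative_eq_rhs) (simp add: fun_eq_iff inner_commute)
  qed
  from MVT2[of 0 1 \<psi>, OF _ this] have "\<psi> 1 - \<psi> 0 = - (?G \<bullet> ?J)"
    by auto
  moreover have "\<psi> 1 = F (t, stop_left y t)"
    using t by (simp add: \<psi>_def \<phi>_def bump_stop_jump)
  moreover have "\<psi> 0 = F (t, stop y t)"
    by (simp add: \<psi>_def \<phi>_def bump_def)
  ultimately show ?thesis by simp
qed

text \<open>While \<open>y\<close> is constant, the stopped path is frozen at
  \<open>stop y a\<close>, so \<open>F\<close> depends on time alone and the horizontal derivative
  is its right derivative. A jump of \<open>y\<close> at \<open>b\<close> is left out by ending with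
  \<open>stop_left\<close>.\<close>

lemma flow_formula:
  assumes lc: "left_cont_functional \<pi> \<Omega> F" and rc: "right_cont_functional \<pi> \<Omega> F"
    and diff: "differentiable_functional \<Omega> F" and rc_D: "right_cont_functional \<pi> \<Omega> (horiz_deriv F)"
    and y: "y \<in> \<Omega>" and ab: "0 \<le> a" "a < b"
    and const: "\<And>s. a \<le> s \<Longrightarrow> s < b \<Longrightarrow> y s = y a"
    and int: "(\<lambda>t. horiz_deriv F (t, stop y t)) integrable_on {a..b}"
  shows "F (b, stop_left y b) - F (a, stop y a) = integral {a..b} (\<lambda>t. horiz_deriv F (t, stop y t))"
proof -
  define f where "f t = F (t, stop y a)" for t
  have stop_eq: "stop y t = stop y a" if "a \<le> t" "t < b" for t
    using that by (intro stop_eq_of_const const) auto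
  have left_eq: "stop_left y t = stop y a" if "a < t" "t \<le> b" for t
    using that ab by (intro stop_left_eq_of_const const) auto
  have f_right: "F (t, stop y t) = f t" if "a \<le> t" "t < b" for t
    by (simp add: f_def stop_eq[OF that])
  have f_left: "F (t, stop_left y t) = f t" if "a < t" "t \<le> b" for t
    by (simp add: f_def left_eq[OF that])
  have right: "(f \<longlongrightarrow> f t) (at_right t)" if t: "a \<le> t" "t < b" for t
  proof -
    have "((\<lambda>s. F (s, stop y s)) \<longlongrightarrow> F (t, stop y t)) (at_right t)"
      using rc y t ab unfolding right_cont_functional_def at_within_Ici_at_right by auto
    moreover have "\<forall>\<^sub>F s in at_right t. F (s, stop y s) = f s"
      using eventually_at_right_real[OF t(2)]
      by eventually_elim (use t in \<open>simp add: f_right\<close>)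
    ultimately show ?thesis
      using t by (simp add: f_right tendsto_cong)
  qed
  \<comment> \<open>The left-stopped form is used because it agrees with \<open>f\<close> also at
    \<open>t = b\<close>, where \<open>stop y b\<close> may already contain a jump.\<close>
  have left: "(f \<longlongrightarrow> f t) (at_left t)" if t: "a < t" "t \<le> b" for t
  proof -
    have "((\<lambda>s. F (s, stop_left y s)) \<longlongrightarrow> F (t, stop_left y t)) (at t within {0..t})"
      using lc y t ab unfolding left_cont_functional_def by auto
    then have "((\<lambda>s. F (s, stop_left y s)) \<longlongrightarrow> F (t, stop_left y t)) (at_left t)"
      using t ab by (simp add: at_within_Icc_at_left)
    moreover have "\<forall>\<^sub>F s in at_left t. F (s, stop_left y s) = f s"
      using eventually_at_left_real[OF t(1)]
      by eventually_elim (use t in \<open>simp add: f_left\<close>)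
    ultimately show ?thesis
      using t by (simp add: f_left tendsto_cong)
  qed
  have "integral {a..b} (\<lambda>t. horiz_deriv F (t, stop y t)) = f b - f a"
  proof (rule integral_right_derivative[where f = f])
    show "continuous_on {a..b} f"
      using ab left right by (auto intro!: continuous_on_IccI filterlim_split_at)
    fix t assume t: "a \<le> t" "t < b"
    show "((\<lambda>t. horiz_deriv F (t, stop y t)) \<longlongrightarrow> horiz_deriv F (t, stop y t)) (at_right t)"
      using rc_D y t ab unfolding right_cont_functional_def at_within_Ici_at_right by auto
    have "(t, stop y t) \<in> stopped_paths \<Omega>"
      using y t ab by (auto simp: stopped_paths_def)
    then have "(horiz_quotient F (t, stop y t) \<longlongrightarrow> horiz_deriv F (t, stop y t)) (at_right 0)"
      by (rule horiz_deriv_tendsto[OF diff])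
    then have "((\<lambda>h. (f (h + t) - f t) / h) \<longlongrightarrow> horiz_deriv F (t, stop y t)) (at_right 0)"
      by (simp add: horiz_quotient_def f_def stop_eq[OF t] add.commute)
    then show "(f has_real_derivative horiz_deriv F (t, stop y t)) (at_right t)"
      unfolding has_field_derivative_iff filterlim_at_right_to_0[of _ _ t] by simp
  qed (use ab int in auto)
  then show ?thesis
    using ab by (simp add: f_left f_right)
qed

section \<open>Partitions and step approximations\<close>

lemma approx_eq:
  assumes sorted: "sorted_wrt (<) (\<pi> n)" and i: "i < length (\<pi> n) - 1"
    and s: "\<pi> n ! i \<le> s" "s < \<pi> n ! Suc i"
  shows "approx \<pi> n x s = x (\<pi> n ! Suc i)"
proof -
  \<comment> \<open>The half-open cells of a strictly increasing list are disjoint, so the defining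
    sum collapses to the summand \<open>i\<close>.\<close>
  have "s \<in> {\<pi> n ! j ..< \<pi> n ! Suc j} \<longleftrightarrow> j = i" if "j < length (\<pi> n) - 1" for j
  proof
    have mono: "\<pi> n ! a \<le> \<pi> n ! b" if "a \<le> b" "b < length (\<pi> n)" for a b
      using sorted_wrt_nth_less[OF sorted, of a b] that by (cases "a = b") auto
    assume "s \<in> {\<pi> n ! j ..< \<pi> n ! Suc j}"
    then show "j = i"
      using s i that mono[of "Suc j" i] mono[of "Suc i" j]
      by (cases j i rule: linorder_cases) (auto simp: less_diff_conv)
  qed (use s in auto)
  then have "approx \<pi> n x s = (\<Sum>j < length (\<pi> n) - 1. if j = i then x (\<pi> n ! Suc j) else 0)"
    unfolding approx_def by (intro sum.cong) (auto simp: indicator_def)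
  also have "\<dots> = x (\<pi> n ! Suc i)"
    using i by (simp add: sum.delta)
  finally show ?thesis .
qed

text \<open>Turns the index set of the Riemann sum into an initial segment and locates the cell
  containing \<open>T\<close>, which exists because \<open>T < last p\<close>.\<close>

lemma partition_index:
  fixes p :: "real list"
  assumes sorted: "sorted_wrt (<) p" and "p \<noteq> []" "hd p = 0" and "0 \<le> T" "T < last p"
  obtains k where "k < length p - 1" "p ! k \<le> T" "T < p ! Suc k"
    "{i. i < length p - 1 \<and> p ! i \<le> T} = {..k}"
proof -
  have less: "p ! a < p ! b" if "a < b" "b < length p" for a b
    using sorted_wrt_nth_less[OF sorted] that by simp
  have mono: "p ! a \<le> p ! b" if "a \<le> b" "b < length p" for a b
    using less[of a b] that by (cases "a = b") auto
  define A where "A = {i. i < length p - 1 \<and> p ! i \<le> T}"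
  have len: "length p - 1 \<noteq> 0"
  proof
    assume "length p - 1 = 0"
    then have "last p = hd p"
      using \<open>p \<noteq> []\<close> by (cases p) auto
    then show False using assms by simp
  qed
  have "finite A" "0 \<in> A"
    using len assms by (auto simp: A_def hd_conv_nth[symmetric])
  define k where "k = Max A"
  have k: "k \<in> A" "\<And>i. i \<in> A \<Longrightarrow> i \<le> k"
    unfolding k_def using \<open>finite A\<close> \<open>0 \<in> A\<close> by (auto intro: Max_in)
  \<comment> \<open>Maximality of \<open>k\<close> settles this only if \<open>Suc k\<close> is
    still an admissible index. Otherwise \<open>p ! Suc k\<close> is the last point, which exceeds
    \<open>T\<close> by assumption.\<close>
  have "T < p ! Suc k"
  proof (cases "Suc k < length p - 1")
    case True
    have "Suc k \<notin> A" using k(2) by fastforce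
    with True show ?thesis by (auto simp: A_def not_le)
  next
    case False
    then have "Suc k = length p - 1" using k(1) by (auto simp: A_def)
    then show ?thesis using assms by (simp add: last_conv_nth)
  qed
  moreover have "A = {..k}"
    using k mono[of _ k] by (fastforce simp: A_def)
  ultimately show thesis
    using that[of k] k(1) by (auto simp: A_def)
qed

section \<open>The formula for piecewise constant paths\<close>

text \<open>Alternates \<open>flow_formula\<close> on the constant stretches with
  \<open>jump_formula\<close> at the nodes \<open>p 1\<close> to \<open>p k\<close>. The node
  \<open>p (Suc k)\<close> lies beyond \<open>T\<close> and only closes the stretch containing
  \<open>T\<close>.\<close>

lemma change_of_variable_piecewise_constant:
  fixes p :: "nat \<Rightarrow> real"
  assumes gen: "generic \<pi> \<Omega>" and F: "F \<in> class_S \<pi> \<Omega>" and y: "y \<in> \<Omega>"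
    and p0: "p 0 = 0" and p: "\<And>i. i \<le> k \<Longrightarrow> p i < p (Suc i)"
    and const: "\<And>i s. i \<le> k \<Longrightarrow> p i \<le> s \<Longrightarrow> s < p (Suc i) \<Longrightarrow> y s = c i"
    and T: "p k \<le> T" "T < p (Suc k)"
    and int: "(\<lambda>t. horiz_deriv F (t, stop y t)) integrable_on {0..T}"
  shows "F (T, stop y T) = F (0, stop y 0) + integral {0..T} (\<lambda>t. horiz_deriv F (t, stop y t))
    + (\<Sum>i<k. vert_deriv F (p (Suc i), stop_left y (p (Suc i))) \<bullet> (c (Suc i) - c i))"
proof -
  define g where "g t = horiz_deriv F (t, stop y t)" for t
  define J where "J i = vert_deriv F (p (Suc i), stop_left y (p (Suc i))) \<bullet> (c (Suc i) - c i)" for i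
  have F': "left_cont_functional \<pi> \<Omega> F" "right_cont_functional \<pi> \<Omega> F"
    "differentiable_functional \<Omega> F" "right_cont_functional \<pi> \<Omega> (horiz_deriv F)"
    "strictly_causal \<Omega> (vert_deriv F)"
    using F by (auto simp: class_S_def cont_functional_def)
  have mono: "p i \<le> p j" if "i \<le> j" "j \<le> k" for i j
    using that
  proof (induction rule: dec_induct)
    case (step n)
    then show ?case using p[of n] by simp
  qed simp
  have pos: "0 \<le> p i" if "i \<le> k" for i
    using mono[of 0 i] that p0 by simp
  have int': "g integrable_on {a..b}" if "0 \<le> a" "b \<le> T" for a b
    using integrable_on_subinterval[OF int, of a b] that by (simp add: g_def[abs_def])
  have flow: "F (b, stop_left y b) - F (p i, stop y (p i)) = integral {p i..b} g"
    \<comment> \<open>The end point \<open>b\<close> is free, so that this serves both full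
      stretches and the last one, cut off at \<open>T\<close>.\<close>
    if i: "i \<le> k" and b: "p i < b" "b \<le> p (Suc i)" "b \<le> T" for i b
    unfolding g_def
  proof (rule flow_formula[OF F'(1-4) y])
    fix s assume "p i \<le> s" "s < b"
    then show "y s = y (p i)"
      using b const[OF i, of s] const[OF i, of "p i"] p[OF i] by simp
  qed (use int' pos i b in \<open>auto simp: g_def[abs_def]\<close>)
  have at_points: "F (p j, stop y (p j)) = F (0, stop y 0) + integral {0..p j} g + (\<Sum>i<j. J i)"
    if "j \<le> k" for j
    using that
  proof (induction j)
    case 0
    then show ?case by (simp add: p0)
  next
    case (Suc j)
    let ?b = "p (Suc j)"
    have j: "j \<le> k" "p j < ?b" "?b \<le> T" "0 \<le> p j"
      using Suc.prems p pos mono[of "Suc j" k] T by auto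
    have "F (?b, stop_left y ?b) - F (p j, stop y (p j)) = integral {p j..?b} g"
      using j by (intro flow) auto
    moreover have "integral {0..p j} g + integral {p j..?b} g = integral {0..?b} g"
      using j by (intro Henstock_Kurzweil_Integration.integral_combine int') auto
    moreover have "jump y ?b = c (Suc j) - c j"
      using left_lim_eq_const[of "p j" ?b y "c j"] j const[of j] const[of "Suc j" ?b] p[of "Suc j"]
        Suc.prems by (simp add: jump_def)
    then have "F (?b, stop y ?b) - F (?b, stop_left y ?b) = J j"
      using jump_formula[OF gen F'(3,5) y, of ?b] j by (simp add: J_def)
    ultimately show ?case
      using Suc.IH j by simp
  qed
  \<comment> \<open>If \<open>T = p k\<close>, nothing is left to integrate. Otherwise
    \<open>y\<close> does not jump at \<open>T\<close>, so \<open>stop y T\<close> and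
    \<open>stop_left y T\<close> coincide.\<close>
  have "F (T, stop y T) - F (p k, stop y (p k)) = integral {p k..T} g"
  proof (cases "T = p k")
    case False
    have eq: "y s = y (p k)" if "p k \<le> s" "s \<le> T" for s
      using that const[of k s] const[of k "p k"] p[of k] T by simp
    have "stop y T = stop y (p k)"
      by (rule stop_eq_of_const, rule eq) (use T in auto)
    moreover have "stop_left y T = stop y (p k)"
      by (rule stop_left_eq_of_const, rule eq) (use T False pos[of k] in auto)
    ultimately show ?thesis
      using flow[of k T] T False by simp
  qed simp
  moreover have "integral {0..p k} g + integral {p k..T} g = integral {0..T} g"
    using T pos[of k] by (intro Henstock_Kurzweil_Integration.integral_combine int') auto
  ultimately show ?thesis
    using at_points[of k] by (simp add: g_def[abs_def] J_def)
qed

text \<open>The formula for the approximation, solved for the Riemann sum. Its jump at a partition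
  point is the increment of \<open>x\<close> over the cell that starts there, so only the summand at
  \<open>0\<close> is extra. Membership in \<open>\<Omega>\<close> is given for the approximation
  stopped at \<open>S\<close>; as \<open>T < S\<close>, the stopping is invisible up to
  \<open>T\<close>.\<close>

lemma riemann_sum_eq:
  assumes gen: "generic \<pi> \<Omega>" and F: "F \<in> class_S \<pi> \<Omega>"
    and part: "sorted_wrt (<) (\<pi> n)" "\<pi> n \<noteq> []" "hd (\<pi> n) = 0" "T < last (\<pi> n)"
    and "0 \<le> T" "T < S" and y: "stop (approx \<pi> n x) S \<in> \<Omega>"
    and int: "set_integrable lborel {0..T} (\<lambda>t. horiz_deriv F (t, stop (approx \<pi> n x) t))"
  shows "riemann_sum \<pi> (vert_deriv F) x T n =
    vert_deriv F (0, stop_left (approx \<pi> n x) 0) \<bullet> (x (\<pi> n ! 1) - x 0)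
    + F (T, stop (approx \<pi> n x) T) - F (0, stop (approx \<pi> n x) 0)
    - (LINT t:{0..T}|lborel. horiz_deriv F (t, stop (approx \<pi> n x) t))"
proof -
  let ?X = "approx \<pi> n x" and ?p = "(!) (\<pi> n)"
  let ?y = "stop ?X S"
  obtain k where k: "k < length (\<pi> n) - 1" "?p k \<le> T" "T < ?p (Suc k)"
    "{i. i < length (\<pi> n) - 1 \<and> ?p i \<le> T} = {..k}"
    using partition_index[OF part(1-3) \<open>0 \<le> T\<close> part(4)] by blast
  have p0: "?p 0 = 0"
    using part by (simp add: hd_conv_nth)
  have less: "?p a < ?p b" if "a < b" "b < length (\<pi> n)" for a b
    using sorted_wrt_nth_less[OF part(1)] that by simp
  \<comment> \<open>The path stopped at \<open>S\<close> need not be constant on the whole last interval, so cut that interval at \<open>S\<close>.\<close>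
  define S' where "S' = min S (?p (Suc k))"
  have stop: "stop ?y t = stop ?X t" if "t \<le> T" for t
    using that \<open>T < S\<close> by (auto simp: stop_def fun_eq_iff min_def)
  have stop_left: "stop_left ?y t = stop_left ?X t" if "0 < t" "t \<le> T" for t
    using that \<open>T < S\<close> by (intro stop_left_cong) (auto simp: stop_def)
  define q where "q i = (if i \<le> k then ?p i else S')" for i
  have le_T: "?p i \<le> T" if "i \<le> k" for i
    using k(4) that by blast
  have q: "q (Suc i) \<le> ?p (Suc i)" "q (Suc i) \<le> S" if "i \<le> k" for i
    using that le_T[of "Suc i"] \<open>T < S\<close> by (auto simp: q_def S'_def le_Suc_eq not_less_eq_eq)
  have eq: "F (T, stop ?y T) = F (0, stop ?y 0)
    + integral {0..T} (\<lambda>t. horiz_deriv F (t, stop ?y t))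
    + (\<Sum>i<k. vert_deriv F (q (Suc i), stop_left ?y (q (Suc i))) \<bullet>
        (x (?p (Suc (Suc i))) - x (?p (Suc i))))"
  proof (rule change_of_variable_piecewise_constant[OF gen F y])
    show "q 0 = 0" by (simp add: q_def p0)
    show "q i < q (Suc i)" if "i \<le> k" for i
      using that less[of i "Suc i"] k le_T[of i] \<open>T < S\<close> by (auto simp: q_def S'_def)
    show "?y s = x (?p (Suc i))" if "i \<le> k" "q i \<le> s" "s < q (Suc i)" for i s
      using approx_eq[of \<pi> n i s x] part(1) that q[of i] k(1)
      by (auto simp: stop_def q_def)
    show "q k \<le> T" "T < q (Suc k)"
      using k \<open>T < S\<close> by (auto simp: q_def S'_def)
    have "(\<lambda>t. horiz_deriv F (t, stop ?X t)) integrable_on {0..T}"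
      using int by (rule set_borel_integral_eq_integral)
    then show "(\<lambda>t. horiz_deriv F (t, stop ?y t)) integrable_on {0..T}"
      by (rule integrable_eq) (simp add: stop)
  qed
  have "integral {0..T} (\<lambda>t. horiz_deriv F (t, stop ?y t))
      = (LINT t:{0..T}|lborel. horiz_deriv F (t, stop ?X t))"
    unfolding set_borel_integral_eq_integral(2)[OF int]
    by (rule integral_cong) (simp add: stop)
  moreover have "(\<Sum>i<k. vert_deriv F (q (Suc i), stop_left ?y (q (Suc i))) \<bullet>
        (x (?p (Suc (Suc i))) - x (?p (Suc i))))
    = (\<Sum>i<k. vert_deriv F (?p (Suc i), stop_left ?X (?p (Suc i))) \<bullet>
        (x (?p (Suc (Suc i))) - x (?p (Suc i))))"
    using less[of 0] p0 k(1) le_T by (intro sum.cong) (auto simp: q_def stop_left)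
  moreover have "riemann_sum \<pi> (vert_deriv F) x T n
    = vert_deriv F (0, stop_left ?X 0) \<bullet> (x (?p 1) - x 0)
      + (\<Sum>i<k. vert_deriv F (?p (Suc i), stop_left ?X (?p (Suc i))) \<bullet>
        (x (?p (Suc (Suc i))) - x (?p (Suc i))))"
    unfolding riemann_sum_def k(4)
    by (simp add: sum.lessThan_Suc_shift p0 flip: lessThan_Suc_atMost del: sum.lessThan_Suc)
  ultimately show ?thesis
    using eq stop[of T] stop[of 0] \<open>0 \<le> T\<close> by simp
qed

section \<open>Passage to the limit\<close>

text \<open>Makes the constant sequence \<open>t\<close> admissible in the right-continuity clause
  for \<open>r n \<ge> prev_point \<pi> n t\<close>; the assumption \<open>0 \<le> t\<close> handles
  the default value \<open>0\<close>.\<close>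

lemma prev_point_le: "0 \<le> t \<Longrightarrow> prev_point \<pi> n t \<le> t"
proof (cases "\<exists>s \<in> set (\<pi> n). s < t")
  case True
  then have "Max {s \<in> set (\<pi> n). s < t} \<in> {s \<in> set (\<pi> n). s < t}"
    by (intro Max_in) auto
  with True show ?thesis by (simp add: prev_point_def)
qed (simp add: prev_point_def)

theorem theorem5p8:
  fixes \<pi> :: "nat \<Rightarrow> real list"
    and \<Omega> :: "('m::finite) path set"
    and F :: "('m, real) functional"
    and x :: "'m path"
    and T :: real
  assumes "partition_sequence \<pi>"
    and "generic \<pi> \<Omega>"
    and "F \<in> class_S \<pi> \<Omega>"
    and "x \<in> \<Omega>"
    and "T \<ge> 0"
  shows "convergent (riemann_sum \<pi> (vert_deriv F) x T) \<and>
         set_integrable lborel {0..T} (\<lambda>t. horiz_deriv F (t, stop x t)) \<and>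
         F (T, stop x T) =
           F (0, stop x 0)
           + (LINT t:{0..T}|lborel. horiz_deriv F (t, stop x t))
           + pathwise_integral \<pi> (vert_deriv F) x T"
proof -
  let ?X = "\<lambda>n. approx \<pi> n x" and ?D = "horiz_deriv F" and ?G = "vert_deriv F"
  have part: "sorted_wrt (<) (\<pi> n)" "\<pi> n \<noteq> []" "hd (\<pi> n) = 0" for n
    using assms(1) by (auto simp: partition_sequence_def)
  have F: "right_cont_functional \<pi> \<Omega> F" "right_cont_functional \<pi> \<Omega> ?D"
    "locally_bounded_functional \<pi> \<Omega> ?D" "left_cont_functional \<pi> \<Omega> ?G"
    using assms(3) by (auto simp: class_S_def cont_functional_def)
  \<comment> \<open>The horizon \<open>T + 1\<close> provides the stopping time strictly after
    \<open>T\<close> that \<open>riemann_sum_eq\<close> asks for. Local boundedness gives membership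
    and the bound with the same \<open>N\<close>.\<close>
  obtain N where N: "\<And>n. N \<le> n \<Longrightarrow> stop (?X n) (T + 1) \<in> \<Omega>"
    and bdd: "bounded {?D (t, stop (?X n) t) | n t. N \<le> n \<and> t \<in> {0..T + 1}}"
    using F(3)[unfolded locally_bounded_functional_def, rule_format, OF assms(4), of "T + 1"] assms(5)
    by auto
  obtain B where B: "\<bar>?D (t, stop (?X n) t)\<bar> \<le> B" if "N \<le> n" "t \<in> {0..T}" for n t
  proof -
    obtain B where bound: "\<forall>v \<in> {?D (t, stop (?X n) t) | n t. N \<le> n \<and> t \<in> {0..T + 1}}. norm v \<le> B"
      using bdd unfolding bounded_iff ..
    have "\<bar>?D (t, stop (?X n) t)\<bar> \<le> B" if "N \<le> n" "t \<in> {0..T}" for n t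
    proof -
      have "?D (t, stop (?X n) t) \<in> {?D (t, stop (?X n) t) | n t. N \<le> n \<and> t \<in> {0..T + 1}}"
        using that by (intro CollectI exI[of _ n] exI[of _ t]) auto
      from bspec[OF bound this] show ?thesis by simp
    qed
    then show thesis by (rule that)
  qed
  have meas: "set_borel_measurable lborel {0..T} (\<lambda>t. ?D (t, stop y t))" if "y \<in> \<Omega>" for y
    using F(2) that unfolding right_cont_functional_def at_within_Ici_at_right
    by (intro borel_measurable_right_continuous) blast
  \<comment> \<open>Only the approximation stopped at \<open>T + 1\<close> is known to lie in
    \<open>\<Omega>\<close>, and the integrands of both paths agree on
    \<open>{0..T}\<close>.\<close>
  have meas_X: "set_borel_measurable lborel {0..T} (\<lambda>t. ?D (t, stop (?X n) t))" if "N \<le> n" for n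
  proof -
    have "stop (stop (?X n) (T + 1)) t = stop (?X n) t" if "t \<in> {0..T}" for t
      using that by (auto simp: stop_def fun_eq_iff min_def)
    then have "(\<lambda>t. indicator {0..T} t *\<^sub>R ?D (t, stop (stop (?X n) (T + 1)) t))
        = (\<lambda>t. indicator {0..T} t *\<^sub>R ?D (t, stop (?X n) t))"
      by (intro ext) (simp add: indicator_def)
    with meas[OF N[OF that]] show ?thesis
      by (simp add: set_borel_measurable_def)
  qed
  have lim_right: "(\<lambda>n. H (t, stop (?X n) t)) \<longlonglongrightarrow> H (t, stop x t)"
    if "right_cont_functional \<pi> \<Omega> H" "0 \<le> t" for H :: "('m, real) functional" and t
  proof -
    have "\<forall>r. (\<forall>n. 0 \<le> r n) \<and> r \<longlonglongrightarrow> t \<and> (\<forall>\<^sub>F n in sequentially. prev_point \<pi> n t \<le> r n)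
        \<longrightarrow> (\<lambda>n. H (r n, stop (?X n) (r n))) \<longlonglongrightarrow> H (t, stop x t)"
      using that(1)[unfolded right_cont_functional_def, rule_format, OF assms(4) that(2)] by simp
    from this[rule_format, of "\<lambda>_. t"] show ?thesis
      using that(2) prev_point_le[OF that(2)] by simp
  qed

  \<comment> \<open>Dominated convergence wants measurability and the bound for every index, hence
    the shift by \<open>N\<close>.\<close>
  define s where "s n t = indicator {0..T} t *\<^sub>R ?D (t, stop (?X (n + N)) t)" for n t
  have "(\<lambda>t. indicator {0..T} t *\<^sub>R ?D (t, stop x t)) \<in> borel_measurable lborel"
    using meas[OF assms(4)] by (simp add: set_borel_measurable_def)
  moreover have "s n \<in> borel_measurable lborel" for n
    using meas_X[of "n + N"] by (simp add: set_borel_measurable_def s_def[abs_def])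
  moreover have "integrable lborel (\<lambda>t. indicator {0..T} t *\<^sub>R B)"
    by (intro integrable_scaleR_left integrable_real_indicator) (auto simp: emeasure_lborel_Icc_eq)
  moreover have "(\<lambda>n. s n t) \<longlonglongrightarrow> indicator {0..T} t *\<^sub>R ?D (t, stop x t)" for t
  proof (cases "t \<in> {0..T}")
    case True
    then show ?thesis
      using LIMSEQ_ignore_initial_segment[OF lim_right[OF F(2), of t], of N] by (simp add: s_def)
  qed (simp add: s_def)
  then have "AE t in lborel. (\<lambda>n. s n t) \<longlonglongrightarrow> indicator {0..T} t *\<^sub>R ?D (t, stop x t)"
    by simp
  moreover have "norm (s n t) \<le> indicator {0..T} t *\<^sub>R B" for n t
    using B[of "n + N" t] by (cases "t \<in> {0..T}") (simp_all add: s_def)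
  then have "AE t in lborel. norm (s n t) \<le> indicator {0..T} t *\<^sub>R B" for n
    by simp
  ultimately have int: "integrable lborel (\<lambda>t. indicator {0..T} t *\<^sub>R ?D (t, stop x t))"
    and int_s: "\<And>n. integrable lborel (s n)"
    and lim_s: "(\<lambda>n. integral\<^sup>L lborel (s n))
      \<longlonglongrightarrow> (LINT t|lborel. indicator {0..T} t *\<^sub>R ?D (t, stop x t))"
    by (rule integrable_dominated_convergence integrable_dominated_convergence2
        integral_dominated_convergence)+
  have int_X: "set_integrable lborel {0..T} (\<lambda>t. ?D (t, stop (?X n) t))" if "N \<le> n" for n
    using int_s[of "n - N"] that by (simp add: set_integrable_def s_def[abs_def])
  have lim_int: "(\<lambda>n. LINT t:{0..T}|lborel. ?D (t, stop (?X n) t))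
      \<longlonglongrightarrow> (LINT t:{0..T}|lborel. ?D (t, stop x t))"
    using lim_s unfolding s_def[abs_def] set_lebesgue_integral_def by (rule LIMSEQ_offset)

  have large: "\<forall>\<^sub>F n in sequentially. T < last (\<pi> n)"
    using assms(1) by (auto simp: partition_sequence_def filterlim_at_top_dense)
  have p0: "\<pi> n ! 0 = 0" for n
    using part(2,3)[of n] by (simp add: hd_conv_nth)
  \<comment> \<open>A partition may be the single point \<open>0\<close>; reaching beyond
    \<open>T \<ge> 0\<close> forces at least one cell, so that \<open>\<pi> n ! 1\<close> is a
    genuine partition point.\<close>
  have first: "\<forall>\<^sub>F n in sequentially. 0 < length (\<pi> n) - 1 \<and> 0 < \<pi> n ! 1"
    using large
  proof eventually_elim
    case (elim n)
    obtain k where k: "k < length (\<pi> n) - 1"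
      using partition_index[OF part \<open>T \<ge> 0\<close> elim] by blast
    then have "\<pi> n ! 0 < \<pi> n ! 1"
      by (intro sorted_wrt_nth_less[OF part(1)]) auto
    with k p0 show ?case by auto
  qed
  have mesh: "\<forall>T>0. \<forall>\<epsilon>>0. \<forall>\<^sub>F n in sequentially.
      \<forall>i < length (\<pi> n) - 1. \<pi> n ! i \<le> T \<longrightarrow> \<pi> n ! Suc i - \<pi> n ! i < \<epsilon>"
    using assms(1) unfolding partition_sequence_def by (elim conjE)
  \<comment> \<open>The mesh condition for the cell of index \<open>0\<close>; any positive horizon
    would do in place of \<open>1\<close>, as this cell starts at \<open>0\<close>.\<close>
  have "(\<lambda>n. \<pi> n ! 1) \<longlonglongrightarrow> 0"
  proof (rule tendstoI)
    fix e :: real assume "0 < e"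
    have "\<forall>\<^sub>F n in sequentially. \<forall>i < length (\<pi> n) - 1. \<pi> n ! i \<le> 1 \<longrightarrow> \<pi> n ! Suc i - \<pi> n ! i < e"
      using mesh \<open>0 < e\<close> zero_less_one by blast
    with first show "\<forall>\<^sub>F n in sequentially. dist (\<pi> n ! 1) 0 < e"
    proof eventually_elim
      case (elim n)
      then have "\<pi> n ! Suc 0 - \<pi> n ! 0 < e"
        using p0[of n] by (intro elim(2)[rule_format]) simp_all
      with elim(1) p0[of n] show ?case by simp
    qed
  qed
  moreover have "\<forall>\<^sub>F n in sequentially. 0 < \<pi> n ! 1"
    using first by eventually_elim simp
  ultimately have "filterlim (\<lambda>n. \<pi> n ! 1) (at_right 0) sequentially"
    by (auto simp: filterlim_at elim: eventually_mono)
  moreover have "(x \<longlongrightarrow> x 0) (at_right 0)"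
    using assms(2,4) by (auto simp: generic_def cadlag_paths_def)
  ultimately have "(\<lambda>n. x (\<pi> n ! 1)) \<longlonglongrightarrow> x 0"
    by (rule filterlim_compose[rotated])
  moreover have prev: "prev_point \<pi> n 0 = 0" for n
  proof -
    have "0 \<le> u" if "u \<in> set (\<pi> n)" for u
      using that part[of n] by (cases "\<pi> n") auto
    then show ?thesis by (force simp: prev_point_def)
  qed
  \<comment> \<open>Since \<open>prev_point \<pi> n 0 = 0\<close>, the constant sequence
    \<open>0\<close> is admissible in left continuity. The gradients at \<open>0\<close> thus
    converge, so the extra summand vanishes in the limit together with
    \<open>x (\<pi> n ! 1) - x 0\<close>.\<close>
  moreover have "(\<lambda>n. ?G (0, stop_left (?X n) 0)) \<longlonglongrightarrow> ?G (0, stop_left x 0)"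
  proof -
    have "\<forall>r. (\<forall>n. 0 \<le> r n) \<and> r \<longlonglongrightarrow> 0 \<and> (\<forall>\<^sub>F n in sequentially. r n \<le> prev_point \<pi> n 0)
        \<longrightarrow> (\<lambda>n. ?G (r n, stop_left (?X n) (r n))) \<longlonglongrightarrow> ?G (0, stop_left x 0)"
      using F(4)[unfolded left_cont_functional_def, rule_format, OF assms(4) order_refl] by simp
    from this[rule_format, of "\<lambda>_. 0"] show ?thesis
      using prev by simp
  qed
  ultimately have "(\<lambda>n. ?G (0, stop_left (?X n) 0) \<bullet> (x (\<pi> n ! 1) - x 0)
      + F (T, stop (?X n) T) - F (0, stop (?X n) 0)
      - (LINT t:{0..T}|lborel. ?D (t, stop (?X n) t)))
    \<longlonglongrightarrow> ?G (0, stop_left x 0) \<bullet> (x 0 - x 0) + F (T, stop x T) - F (0, stop x 0)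
      - (LINT t:{0..T}|lborel. ?D (t, stop x t))"
    using \<open>T \<ge> 0\<close> by (intro tendsto_intros lim_right F(1) lim_int) simp_all
  moreover have "\<forall>\<^sub>F n in sequentially. ?G (0, stop_left (?X n) 0) \<bullet> (x (\<pi> n ! 1) - x 0)
      + F (T, stop (?X n) T) - F (0, stop (?X n) 0)
      - (LINT t:{0..T}|lborel. ?D (t, stop (?X n) t)) = riemann_sum \<pi> ?G x T n"
    using large eventually_ge_at_top[of N]
  proof eventually_elim
    case (elim n)
    show ?case
      using riemann_sum_eq[OF assms(2,3) part elim(1) \<open>T \<ge> 0\<close> _ N[OF elim(2)] int_X[OF elim(2)]]
      by simp
  qed
  ultimately have lim: "riemann_sum \<pi> ?G x T \<longlonglongrightarrow> F (T, stop x T) - F (0, stop x 0)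
      - (LINT t:{0..T}|lborel. ?D (t, stop x t))"
    by (simp add: Lim_transform_eventually)
  then have "pathwise_integral \<pi> ?G x T = F (T, stop x T) - F (0, stop x 0)
      - (LINT t:{0..T}|lborel. ?D (t, stop x t))"
    unfolding pathwise_integral_def by (rule limI)
  with lim int show ?thesis
    by (auto simp: convergent_def set_integrable_def)
qed

end
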